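(* Let $0<\varepsilon<1$ and let $r\ge 2$ be an integer. For infinitely many $n$, there exists an $n$-vertex $r$-digraph $G$ with $|E(G)|\ge\left(1-\frac1r-\varepsilon\right)n_{(r)}$ such that every path in $G$ has at most $\frac{r^3}{\varepsilon}$ vertices.
   Context: An $r$-digraph $G$ consists of a finite vertex set $V(G)$ and an edge set $E(G)$ whose elements are ordered lists of $r$ distinct vertices. A path (tight path) in $G$ is a sequence $v_1\ldots v_s$ of distinct vertices of $G$ such that each list of $r$ consecutive vertices $(v_i,\ldots,v_{i+r-1})$, $1\le i\le s-r+1$, is an edge of $G$. $n_{(r)}=n(n-1)\cdots(n-r+1)$ is the falling factorial. *)

theory Defs
  imports Complex_Main
begin

record 'a rdigraph =
  verts :: "'a set"
  edges :: "'a list set"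

definition is_rdigraph :: "nat \<Rightarrow> 'a rdigraph \<Rightarrow> bool" where
  "is_rdigraph r G \<longleftrightarrow> finite (verts G) \<and>
     (\<forall>e \<in> edges G. length e = r \<and> distinct e \<and> set e \<subseteq> verts G)"

(* take r (drop i p) is the block of r consecutive vertices of p starting at the (0-based) index i.
   Sequences of fewer than r distinct vertices are (vacuously) paths. *)
definition tight_path :: "nat \<Rightarrow> 'a rdigraph \<Rightarrow> 'a list \<Rightarrow> bool" where
  "tight_path r G p \<longleftrightarrow> distinct p \<and> set p \<subseteq> verts G \<and>
     (\<forall>i. i + r \<le> length p \<longrightarrow> take r (drop i p) \<in> edges G)"

(* For n < r one factor is n - n = 0, so truncated subtraction gives the correct value 0. *)
definition falling_factorial :: "nat \<Rightarrow> nat \<Rightarrow> nat" where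
  "falling_factorial n r = (\<Prod>i<r. n - i)"

end

theory Submission
  imports Defs
begin

text \<open>
  Split the vertices into \<open>k = \<lceil>(r - 1) / \<epsilon>\<rceil>\<close> linearly ordered classes of equal size, and let a
  list of \<open>r\<close> distinct vertices be an edge iff its first vertex does not lie in the highest
  class that the list meets. Along a tight path, every vertex followed by at least \<open>r - 1\<close> others
  is followed, within \<open>r - 1\<close> steps, by a vertex of a higher class; so a path has at most
  \<open>k (r - 1)\<close> vertices. A non-edge either has its first vertex strictly above all others, which
  by symmetry happens for at most a fraction \<open>1 / r\<close> of the lists, or has another vertex in the
  class of the first one, which happens for at most a fraction \<open>(r - 1) / k \<le> \<epsilon>\<close>.
\<close>

section \<open>Counting lists of distinct elements\<close>

definition distinct_lists :: "'a set \<Rightarrow> nat \<Rightarrow> 'a list set" where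
  "distinct_lists A r = {xs. length xs = r \<and> distinct xs \<and> set xs \<subseteq> A}"

lemma finite_distinct_lists:
  assumes "finite A" shows "finite (distinct_lists A r)"
  by (rule finite_subset[OF _ finite_lists_length_eq[OF assms, of r]])
     (auto simp: distinct_lists_def)

lemma falling_factorial_Suc: "falling_factorial n (Suc r) = falling_factorial n r * (n - r)"
  by (simp add: falling_factorial_def)

lemma falling_factorial_eq_prod:
  "r \<le> n \<Longrightarrow> falling_factorial n r = \<Prod>{n - r + 1..n}"
proof (induction r)
  case (Suc r)
  then have "{n - Suc r + 1..n} = insert (n - r) {n - r + 1..n}" by auto
  with Suc show ?case by (simp add: falling_factorial_Suc)
qed (simp add: falling_factorial_def)

lemma card_distinct_lists:
  assumes "finite A" shows "card (distinct_lists A r) = falling_factorial (card A) r"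
proof (cases "r \<le> card A")
  case True
  then show ?thesis
    using card_lists_distinct_length_eq[OF assms True]
    by (simp add: distinct_lists_def falling_factorial_eq_prod)
next
  case False
  then have "distinct_lists A r = {}"
    using assms by (auto simp: distinct_lists_def) (metis card_mono distinct_card)
  moreover have "falling_factorial (card A) r = 0"
    using False by (auto simp: falling_factorial_def)
  ultimately show ?thesis by simp
qed

section \<open>Upper bounds for the two kinds of non-edges\<close>

definition dominated_by :: "('a \<Rightarrow> nat) \<Rightarrow> nat \<Rightarrow> 'a list \<Rightarrow> bool" where
  "dominated_by c i xs \<longleftrightarrow> (\<forall>j < length xs. j \<noteq> i \<longrightarrow> c (xs ! j) < c (xs ! i))"

text \<open>Swapping positions \<open>0\<close> and \<open>i\<close> turns a list dominated by its
  head into one dominated by entry \<open>i\<close>. So each of the \<open>r\<close> positions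
  accounts for at least as many lists as position \<open>0\<close>.\<close>

lemma card_dominated_le:
  assumes "finite A"
  shows "r * card {xs \<in> distinct_lists A r. dominated_by c 0 xs} \<le> card (distinct_lists A r)"
proof -
  let ?B = "\<lambda>i. {xs \<in> distinct_lists A r. dominated_by c i xs}"
  have fin: "finite (?B i)" for i
    using finite_distinct_lists[OF assms] by simp
  have le: "card (?B 0) \<le> card (?B i)" if "i < r" for i
  proof (rule card_inj_on_le[OF _ _ fin])
    \<comment> \<open>The swap is its own inverse on these lists, hence injective.\<close>
    let ?f = "\<lambda>xs :: 'a list. xs[0 := xs ! i, i := xs ! 0]"
    have inv: "?f (?f xs) = xs" if "xs \<in> ?B 0" for xs
      using that \<open>i < r\<close>
      by (intro nth_equalityI) (auto simp: distinct_lists_def nth_list_update)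
    show "inj_on ?f (?B 0)"
      by (rule inj_on_inverseI[where g = ?f]) (rule inv)
    show "?f ` ?B 0 \<subseteq> ?B i"
    proof clarify
      fix xs assume xs: "xs \<in> distinct_lists A r" "dominated_by c 0 xs"
      then have bounds: "0 < length xs" "i < length xs"
        using \<open>i < r\<close> by (auto simp: distinct_lists_def)
      have "?f xs \<in> distinct_lists A r"
        using xs(1) distinct_swap[OF bounds] set_swap[OF bounds]
        by (simp add: distinct_lists_def)
      moreover have "dominated_by c i (?f xs)"
        using xs(2) bounds by (auto simp: dominated_by_def nth_list_update)
      ultimately show "?f xs \<in> distinct_lists A r \<and> dominated_by c i (?f xs)" ..
    qed
  qed
  have "r * card (?B 0) = (\<Sum>i<r. card (?B 0))" by simp
  also have "\<dots> \<le> (\<Sum>i<r. card (?B i))" by (intro sum_mono le) simp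
  also have "\<dots> = card (\<Union>i<r. ?B i)"
  \<comment> \<open>Domination is strict, so no list is dominated at two positions.\<close>
  proof (rule card_UN_disjoint[symmetric])
    show "\<forall>i\<in>{..<r}. \<forall>j\<in>{..<r}. i \<noteq> j \<longrightarrow> ?B i \<inter> ?B j = {}"
      unfolding distinct_lists_def dominated_by_def by (auto, metis less_asym)
  qed (use fin in auto)
  also have "\<dots> \<le> card (distinct_lists A r)"
    by (intro card_mono finite_distinct_lists assms) auto
  finally show ?thesis .
qed

text \<open>Deleting entry \<open>j\<close> leaves \<open>r\<close> distinct elements and, since
  \<open>0 < j\<close>, keeps the head. The deleted entry lies in the class of the head but differs
  from it, which leaves at most \<open>m - 1\<close> values.\<close>

lemma card_tie_le:
  assumes "finite A" and "0 < j" and "j \<le> r"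
    and class_le: "\<And>a. card {v \<in> A. c v = a} \<le> m"
  shows "card {xs \<in> distinct_lists A (Suc r). c (xs ! j) = c (xs ! 0)}
           \<le> falling_factorial (card A) r * (m - 1)"
proof -
  \<comment> \<open>A pair holds the shortened list and the deleted entry; \<open>?ins\<close> puts
    the entry back. For an upper bound it suffices that the image of \<open>?S\<close> contains
    every tied list.\<close>
  let ?S = "SIGMA ys : distinct_lists A r. {v \<in> A. c v = c (ys ! 0)} - {ys ! 0}"
  let ?ins = "\<lambda>(ys, v). take j ys @ v # drop j ys"
  have finS: "finite ?S"
    using assms(1) by (intro finite_SigmaI finite_distinct_lists) auto
  have "{xs \<in> distinct_lists A (Suc r). c (xs ! j) = c (xs ! 0)} \<subseteq> ?ins ` ?S"
  proof
    fix xs assume "xs \<in> {xs \<in> distinct_lists A (Suc r). c (xs ! j) = c (xs ! 0)}"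
    then have xs: "length xs = Suc r" "distinct xs" "set xs \<subseteq> A" "c (xs ! j) = c (xs ! 0)"
      by (auto simp: distinct_lists_def)
    define ys where "ys = take j xs @ drop (Suc j) xs"
    have split: "xs = take j xs @ xs ! j # drop (Suc j) xs"
      using xs(1) assms(3) by (intro id_take_nth_drop) simp
    have "distinct ys" "set ys \<subseteq> A"
      using xs(2,3) unfolding ys_def by (subst (asm) (1 2) split; auto)+
    moreover have "length ys = r" "ys ! 0 = xs ! 0"
      using xs(1) assms(2,3) by (auto simp: ys_def nth_append)
    moreover have "xs ! j \<noteq> xs ! 0" "xs ! j \<in> A"
      using xs assms(2,3) by (auto simp: nth_eq_iff_index_eq)
    ultimately have "(ys, xs ! j) \<in> ?S"
      using xs(4) by (auto simp: distinct_lists_def)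
    moreover have "xs = ?ins (ys, xs ! j)"
      using split xs(1) assms(3) by (simp add: ys_def)
    ultimately show "xs \<in> ?ins ` ?S" by blast
  qed
  then have "card {xs \<in> distinct_lists A (Suc r). c (xs ! j) = c (xs ! 0)} \<le> card ?S"
    by (rule surj_card_le[OF finS])
  also have "\<dots> = (\<Sum>ys\<in>distinct_lists A r. card ({v \<in> A. c v = c (ys ! 0)} - {ys ! 0}))"
    using assms(1) by (intro card_SigmaI finite_distinct_lists) auto
  also have "\<dots> \<le> (\<Sum>ys\<in>distinct_lists A r. m - 1)"
  proof (rule sum_mono)
    fix ys assume "ys \<in> distinct_lists A r"
    \<comment> \<open>By \<open>0 < j\<close> and \<open>j \<le> r\<close> the list
      \<open>ys\<close> is nonempty, so its head is a member of the class and its removal lowers the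
      size by one.\<close>
    then have "ys ! 0 \<in> A"
      using assms(2,3) nth_mem[of 0 ys] unfolding distinct_lists_def by fastforce
    then show "card ({v \<in> A. c v = c (ys ! 0)} - {ys ! 0}) \<le> m - 1"
      using class_le[of "c (ys ! 0)"] by (simp add: card_Diff_singleton diff_le_mono)
  qed
  also have "\<dots> = falling_factorial (card A) r * (m - 1)"
    by (simp add: card_distinct_lists[OF assms(1)])
  finally show ?thesis .
qed

section \<open>The ascending digraph and its tight paths\<close>

definition ascending_rdigraph :: "'a set \<Rightarrow> ('a \<Rightarrow> nat) \<Rightarrow> nat \<Rightarrow> 'a rdigraph" where
  "ascending_rdigraph A c r =
     \<lparr>verts = A, edges = {xs \<in> distinct_lists A r. \<exists>j<r. c (xs ! 0) < c (xs ! j)}\<rparr>"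

lemma is_rdigraph_ascending:
  "finite A \<Longrightarrow> is_rdigraph r (ascending_rdigraph A c r)"
  by (auto simp: is_rdigraph_def ascending_rdigraph_def distinct_lists_def)

text \<open>Induction on \<open>k - c (p ! i)\<close>. If at least \<open>r\<close> vertices remain,
  the edge at \<open>i\<close> leads to a higher class at most \<open>r - 1\<close> positions later;
  otherwise at most \<open>r - 1\<close> vertices remain.\<close>

lemma tight_path_ascending_suffix:
  assumes "tight_path r (ascending_rdigraph A c r) p" and "\<And>v. v \<in> A \<Longrightarrow> c v < k"
    and "i < length p"
  shows "length p \<le> i + (k - c (p ! i)) * (r - 1)"
  using assms(3)
proof (induction "k - c (p ! i)" arbitrary: i rule: less_induct)
  case less
  have lt: "c (p ! i') < k" if "i' < length p" for i'
    using assms(1,2) nth_mem[OF that]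
    by (auto simp: tight_path_def ascending_rdigraph_def subset_iff)
  \<comment> \<open>The difference is positive, so even from the top class one summand
    \<open>r - 1\<close> is left for the final vertices.\<close>
  obtain d where d: "k - c (p ! i) = Suc d"
    using lt[OF less.prems] by (metis Suc_diff_Suc)
  show ?case
  proof (cases "i + r \<le> length p")
    case True
    then have "take r (drop i p) \<in> edges (ascending_rdigraph A c r)"
      using assms(1) by (simp add: tight_path_def)
    then obtain j where j: "j < r" "c (p ! i) < c (p ! (i + j))"
      using True by (auto simp: ascending_rdigraph_def)
    have "k - c (p ! (i + j)) \<le> d" "i + j < length p"
      using j d True by auto
    moreover have "j \<le> r - 1" using j by simp
    ultimately have "length p \<le> i + (r - 1) + (k - c (p ! (i + j))) * (r - 1)"
      using less.hyps[of "i + j"] d by linarith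
    also have "\<dots> \<le> i + (r - 1) + d * (r - 1)"
      using \<open>k - c (p ! (i + j)) \<le> d\<close> by simp
    finally show ?thesis by (simp add: d)
  next
    case False
    then have "length p \<le> i + (r - 1)" by linarith
    then show ?thesis by (simp add: d)
  qed
qed

lemma length_tight_path_ascending_le:
  assumes "tight_path r (ascending_rdigraph A c r) p" and "\<And>v. v \<in> A \<Longrightarrow> c v < k"
  shows "length p \<le> k * (r - 1)"
proof (cases p)
  case (Cons v q)
  then have "length p \<le> 0 + (k - c (p ! 0)) * (r - 1)"
    by (intro tight_path_ascending_suffix[OF assms]) auto
  also have "\<dots> \<le> k * (r - 1)" by simp
  finally show ?thesis .
qed simp

section \<open>Lower bound for the number of edges\<close>

lemma card_edges_ascending_ge:
  assumes "finite A" and "card A = k * m" and "0 < r" and "r - 1 \<le> k" and "0 < k"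
    and class_le: "\<And>a. card {v \<in> A. c v = a} \<le> m"
  shows "(1 - 1 / real r - (real r - 1) / real k) * real (falling_factorial (card A) r)
           \<le> real (card (edges (ascending_rdigraph A c r)))"
proof -
  define F where "F = falling_factorial (card A) r"
  define E where "E = edges (ascending_rdigraph A c r)"
  define B where "B = {xs \<in> distinct_lists A r. dominated_by c 0 xs}"
  define T where "T = (\<lambda>j. {xs \<in> distinct_lists A r. c (xs ! j) = c (xs ! 0)})"
  have fin: "finite E" "finite B" "finite (\<Union>j\<in>{1..<r}. T j)"
    using finite_distinct_lists[OF assms(1)]
    by (auto simp: E_def B_def T_def ascending_rdigraph_def)
  have cover: "distinct_lists A r \<subseteq> E \<union> B \<union> (\<Union>j\<in>{1..<r}. T j)"
  proof
    fix xs assume xs: "xs \<in> distinct_lists A r"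
    then have len: "length xs = r" by (simp add: distinct_lists_def)
    show "xs \<in> E \<union> B \<union> (\<Union>j\<in>{1..<r}. T j)"
    proof (rule ccontr)
      assume not_in: "xs \<notin> E \<union> B \<union> (\<Union>j\<in>{1..<r}. T j)"
      \<comment> \<open>Outside \<open>B\<close>, some later entry has a class not below that of the
        head; outside \<open>E\<close>, it is not above either, so the two classes tie.\<close>
      then obtain j where j: "j < r" "j \<noteq> 0" "\<not> c (xs ! j) < c (xs ! 0)"
        using xs len by (auto simp: B_def dominated_by_def)
      moreover have "\<not> c (xs ! 0) < c (xs ! j)"
        using not_in xs j(1) by (auto simp: E_def ascending_rdigraph_def)
      ultimately have "xs \<in> T j" "j \<in> {1..<r}"
        using xs by (auto simp: T_def)
      with not_in show False by blast
    qed
  qed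
  have "real r * real (card B) \<le> real F"
    using card_dominated_le[OF assms(1), of r c]
    by (simp add: B_def F_def card_distinct_lists[OF assms(1)] flip: of_nat_mult)
  then have B: "real (card B) \<le> real F / real r"
    using assms(3) by (simp add: field_simps)
  have T: "real (card (T j)) \<le> real F / real k" if "j \<in> {1..<r}" for j
  proof -
    \<comment> \<open>The left side is \<open>card A - k\<close>, and \<open>r - 1 \<le> k\<close>.
      Thus \<open>k\<close> times the tie bound is at most the falling factorial with its last
      factor restored.\<close>
    have "k * (m - 1) \<le> card A - (r - 1)"
      using assms(2,4) by (simp add: diff_mult_distrib2)
    have "j \<le> r - 1" using that by auto
    then have "card (T j) \<le> falling_factorial (card A) (r - 1) * (m - 1)"
      using card_tie_le[of A j "r - 1" c m] assms(1,3) that class_le by (simp add: T_def)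
    then have "k * card (T j) \<le> falling_factorial (card A) (r - 1) * (k * (m - 1))"
      by (metis mult.left_commute mult_le_mono2)
    also have "\<dots> \<le> falling_factorial (card A) (r - 1) * (card A - (r - 1))"
      using \<open>k * (m - 1) \<le> card A - (r - 1)\<close> by simp
    also have "\<dots> = F"
      using assms(3) falling_factorial_Suc[of "card A" "r - 1"] by (simp add: F_def)
    finally have "real k * real (card (T j)) \<le> real F" by (simp flip: of_nat_mult)
    then show ?thesis using assms(5) by (simp add: field_simps)
  qed
  have "F = card (distinct_lists A r)"
    by (simp add: F_def card_distinct_lists[OF assms(1)])
  also have "\<dots> \<le> card (E \<union> B \<union> (\<Union>j\<in>{1..<r}. T j))"
    using fin by (intro card_mono cover) auto
  also have "\<dots> \<le> card E + card B + (\<Sum>j\<in>{1..<r}. card (T j))"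
    by (intro order_trans[OF card_Un_le] add_mono card_Un_le card_UN_le) auto
  finally have "real F \<le> real (card E + card B + (\<Sum>j\<in>{1..<r}. card (T j)))"
    by (rule of_nat_mono)
  also have "\<dots> = real (card E) + real (card B) + (\<Sum>j\<in>{1..<r}. real (card (T j)))"
    by simp
  also have "\<dots> \<le> real (card E) + real F / real r + (\<Sum>j\<in>{1..<r}. real F / real k)"
    by (intro add_mono sum_mono order_refl B T)
  also have "\<dots> = real (card E) + real F / real r + (real r - 1) * (real F / real k)"
    using assms(3) by (simp add: of_nat_diff)
  finally show ?thesis
    by (simp add: E_def F_def algebra_simps)
qed

section \<open>Choice of the number and size of the classes\<close>

theorem lemma31:
  fixes \<epsilon> :: real and r :: nat
  assumes "0 < \<epsilon>" and "\<epsilon> < 1" and "r \<ge> 2"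
  shows "infinite {n :: nat. \<exists>G :: nat rdigraph.
           is_rdigraph r G \<and> card (verts G) = n \<and>
           real (card (edges G)) \<ge> (1 - 1 / real r - \<epsilon>) * real (falling_factorial n r) \<and>
           (\<forall>p. tight_path r G p \<longrightarrow> real (length p) \<le> real r ^ 3 / \<epsilon>)}"
    (is "infinite ?N")
proof -
  \<comment> \<open>Rounding up keeps the loss \<open>(r - 1) / k\<close> from ties at most
    \<open>\<epsilon>\<close>; the excess of less than one is absorbed in the path bound.\<close>
  define k where "k = nat \<lceil>(real r - 1) / \<epsilon>\<rceil>"
  have pos: "0 < (real r - 1) / \<epsilon>" using assms by simp
  have k_ge: "(real r - 1) / \<epsilon> \<le> real k" unfolding k_def by linarith
  have k_le: "real k \<le> (real r - 1) / \<epsilon> + 1" using pos unfolding k_def by linarith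
  have k_pos: "0 < k" using pos k_ge by linarith
  have eps: "(real r - 1) / real k \<le> \<epsilon>"
    using k_ge k_pos assms(1) by (simp add: field_simps)
  have "real r - 1 \<le> (real r - 1) / \<epsilon>"
    using assms mult_left_le[of \<epsilon> "real r - 1"] by (simp add: pos_le_divide_eq)
  with k_ge have r_le: "r - 1 \<le> k" by linarith
  have len: "real (k * (r - 1)) \<le> real r ^ 3 / \<epsilon>"
  proof -
    have "real (k * (r - 1)) = real k * (real r - 1)"
      using assms(3) by (simp add: of_nat_diff)
    \<comment> \<open>Enlarging the rounding term \<open>1\<close> to \<open>1 / \<epsilon>\<close>
      makes the first factor exactly \<open>r / \<epsilon>\<close>, so that even
      \<open>r ^ 2 / \<epsilon>\<close> bounds the path length.\<close>
    also have "\<dots> \<le> ((real r - 1) / \<epsilon> + 1 / \<epsilon>) * real r"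
    proof (rule mult_mono)
      have "1 \<le> 1 / \<epsilon>" using assms by simp
      then show "real k \<le> (real r - 1) / \<epsilon> + 1 / \<epsilon>" using k_le by linarith
    qed (use assms in auto)
    also have "\<dots> = real r ^ 2 / \<epsilon>"
      using assms(1) by (simp add: field_simps power2_eq_square)
    also have "\<dots> \<le> real r ^ 3 / \<epsilon>"
      using assms by (intro divide_right_mono power_increasing) auto
    finally show ?thesis .
  qed
  have "k * Suc m \<in> ?N" for m
  proof -
    define A where "A = {..<k * Suc m}"
    \<comment> \<open>The classes are \<open>k\<close> blocks of \<open>Suc m\<close> consecutive
      numbers; \<open>Suc\<close> keeps the divisor nonzero.\<close>
    define c where "c = (\<lambda>v. v div Suc m)"
    have A: "finite A" "card A = k * Suc m" by (simp_all add: A_def)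
    have "c v < k" if "v \<in> A" for v
      using that by (simp add: A_def c_def less_mult_imp_div_less)
    then have path: "real (length p) \<le> real r ^ 3 / \<epsilon>"
      if "tight_path r (ascending_rdigraph A c r) p" for p
      using length_tight_path_ascending_le[OF that, of k] len
      by (meson of_nat_mono order_trans)
    have "card {v \<in> A. c v = a} \<le> Suc m" for a
    proof -
      have "{v \<in> A. c v = a} \<subseteq> {a * Suc m..<a * Suc m + Suc m}"
        using dividend_less_div_times[of "Suc m"] by (auto simp: c_def add.commute simp del: mult_Suc_right)
      from card_mono[OF _ this] show ?thesis by simp
    qed
    with A have "(1 - 1 / real r - (real r - 1) / real k) * real (falling_factorial (k * Suc m) r)
        \<le> real (card (edges (ascending_rdigraph A c r)))"
      using card_edges_ascending_ge[of A k "Suc m" r c] assms(3) r_le k_pos by simp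
    moreover have "(1 - 1 / real r - \<epsilon>) * real (falling_factorial (k * Suc m) r)
        \<le> (1 - 1 / real r - (real r - 1) / real k) * real (falling_factorial (k * Suc m) r)"
      using eps by (intro mult_right_mono) auto
    ultimately have "(1 - 1 / real r - \<epsilon>) * real (falling_factorial (k * Suc m) r)
        \<le> real (card (edges (ascending_rdigraph A c r)))"
      by linarith
    moreover have "card (verts (ascending_rdigraph A c r)) = k * Suc m"
      using A by (simp add: ascending_rdigraph_def)
    ultimately show ?thesis
      using is_rdigraph_ascending[OF A(1)] path by blast
  qed
  then have "range (\<lambda>m. k * Suc m) \<subseteq> ?N" by blast
  \<comment> \<open>Since \<open>k\<close> is positive, different \<open>m\<close> give different
    vertex numbers.\<close>
  moreover have "infinite (range (\<lambda>m. k * Suc m))"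
    using finite_imageD[of "\<lambda>m. k * Suc m" UNIV] k_pos by (auto simp: inj_def)
  ultimately show ?thesis by (rule infinite_super)
qed

end
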